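(* Let $\delta>0$, $\mathbb P$ a probability measure and $\phi$ as in the context. Then for $\Lambda\in\mathcal H_I$, $$\sup_{\mathbb Q\in\mathcal P_\phi(\mathbb P,\delta)}\Lambda\mathrm{VaR}^{\mathbb Q}=\Lambda\mathrm{VaR}^{g_{\phi,\delta}\circ\mathbb P},$$ and for $\alpha\in(0,1)$, $\sup_{\mathbb Q\in\mathcal P_\phi(\mathbb P,\delta)}\mathrm{VaR}^{\mathbb Q}_\alpha=\mathrm{VaR}_\alpha^{g_{\phi,\delta}\circ\mathbb P}$ (as functionals on $\mathcal X$). Moreover, if $\phi:[0,\infty)\to\mathbb R$ is strictly convex with $\lim_{x\to\infty}\phi(x)/x=\infty$, then $$\sup_{\mathbb Q\in\mathcal P_\phi(\mathbb P,\delta)}\Lambda\mathrm{VaR}^{\mathbb Q}=(g^{-1}_{\phi,\delta}\circ\Lambda)\mathrm{VaR}^{\mathbb P},\qquad \sup_{\mathbb Q\in\mathcal P_\phi(\mathbb P,\delta)}\mathrm{VaR}^{\mathbb Q}_\alpha=\mathrm{VaR}^{\mathbb P}_{g^{-1}_{\phi,\delta}(\alpha)},$$ and for every $X\in\mathcal X$, $$\lim_{\delta\downarrow0}\sup_{\mathbb Q\in\mathcal P_\phi(\mathbb P,\delta)}\Lambda\mathrm{VaR}^{\mathbb Q}(X)=\lim_{\delta\downarrow0}(g^{-1}_{\phi,\delta}\circ\Lambda)\mathrm{VaR}^{\mathbb P}(X)=\Lambda\mathrm{VaR}^{+,\mathbb P}(X).$$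
   Context: $(\Omega,\mathcal F)$ measurable space, $\mathcal X$ a set of real-valued random variables containing the bounded ones. For a capacity $w$ (monotone set function $\mathcal F\to[0,1]$ with $w(\emptyset)=0$, $w(\Omega)=1$; probability measures and $g\circ\mathbb P$ for increasing $g:[0,1]\to[0,1]$ with $g(0)=0,g(1)=1$ are capacities) and $\Lambda:\mathbb R\to[0,1]$: $\Lambda\mathrm{VaR}^w(X)=\inf\{x: w(X>x)\le\Lambda(x)\}$, $\Lambda\mathrm{VaR}^{+,w}(X)=\sup\{x: w(X>x)\ge\Lambda(x)\}$ ($\inf\emptyset=\infty$, $\sup\emptyset=-\infty$); $\mathrm{VaR}^w_\alpha$ is $\Lambda\mathrm{VaR}^w$ with $\Lambda\equiv\alpha$. $\mathcal H_I$: increasing functions $\mathbb R\to(0,1)$. $\phi:[0,\infty)\to\mathbb R\cup\{\infty\}$ convex with $\phi(1)=0$, $\phi(0)=\lim_{x\downarrow0}\phi(x)$; $D_\phi(\mathbb Q\|\mathbb P)=\mathbb E^{\mathbb P}[\phi(\mathrm d\mathbb Q/\mathrm d\mathbb P)]$ for $\mathbb Q\ll\mathbb P$; $\mathcal P_\phi(\mathbb P,\delta)=\{\mathbb Q\ll\mathbb P:D_\phi(\mathbb Q\|\mathbb P)\le\delta\}$. $g_{\phi,\delta}(0)=0$, $g_{\phi,\delta}(1)=1$, $g_{\phi,\delta}(x)=\sup\{t\in[x,1]: x\phi(t/x)+(1-x)\phi((1-t)/(1-x))\le\delta\}$ for $x\in(0,1)$. Under the strict convexity and superlinearity assumptions,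 $g_{\phi,\delta}$ is continuous and strictly increasing from $[0,x_\delta]$ onto $[0,1]$ and equals $1$ on $[x_\delta,1]$ for some $x_\delta\in(0,1)$; $g^{-1}_{\phi,\delta}:[0,1)\to[0,x_\delta)$ denotes the inverse of this restriction, so $g^{-1}_{\phi,\delta}\circ\Lambda$ is well defined for $\Lambda$ with values in $(0,1)$. *)

theory Defs
  imports "HOL-Probability.Probability"
begin

definition LVaR :: "'a measure \<Rightarrow> (real \<Rightarrow> real) \<Rightarrow> ('a set \<Rightarrow> real) \<Rightarrow> ('a \<Rightarrow> real) \<Rightarrow> ereal" where
  "LVaR M \<Lambda> w X = Inf {ereal x | x. w {\<omega> \<in> space M. X \<omega> > x} \<le> \<Lambda> x}"

definition LVaR_plus :: "'a measure \<Rightarrow> (real \<Rightarrow> real) \<Rightarrow> ('a set \<Rightarrow> real) \<Rightarrow> ('a \<Rightarrow> real) \<Rightarrow> ereal" where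
  "LVaR_plus M \<Lambda> w X = Sup {ereal x | x. w {\<omega> \<in> space M. X \<omega> > x} \<ge> \<Lambda> x}"

definition VaR :: "'a measure \<Rightarrow> real \<Rightarrow> ('a set \<Rightarrow> real) \<Rightarrow> ('a \<Rightarrow> real) \<Rightarrow> ereal" where
  "VaR M \<alpha> w X = LVaR M (\<lambda>_. \<alpha>) w X"

definition in_H_I :: "(real \<Rightarrow> real) \<Rightarrow> bool" where
  "in_H_I \<Lambda> \<longleftrightarrow> mono \<Lambda> \<and> (\<forall>x. 0 < \<Lambda> x \<and> \<Lambda> x < 1)"

definition phi_admissible :: "(real \<Rightarrow> ereal) \<Rightarrow> bool" where
  "phi_admissible \<phi> \<longleftrightarrow>
     (\<forall>x\<ge>0. \<phi> x \<noteq> -\<infinity>) \<and>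
     (\<forall>x\<ge>0. \<forall>y\<ge>0. \<forall>t::real. 0 \<le> t \<and> t \<le> 1 \<longrightarrow>
        \<phi> (t * x + (1 - t) * y) \<le> ereal t * \<phi> x + ereal (1 - t) * \<phi> y) \<and>
     \<phi> 1 = 0 \<and>
     (\<phi> \<longlongrightarrow> \<phi> 0) (at_right 0)"

definition phi_strict_superlinear :: "(real \<Rightarrow> ereal) \<Rightarrow> bool" where
  "phi_strict_superlinear \<phi> \<longleftrightarrow>
     (\<forall>x\<ge>0. \<bar>\<phi> x\<bar> \<noteq> \<infinity>) \<and>
     (\<forall>x\<ge>0. \<forall>y\<ge>0. \<forall>t::real. x \<noteq> y \<and> 0 < t \<and> t < 1 \<longrightarrow>
        real_of_ereal (\<phi> (t * x + (1 - t) * y)) < t * real_of_ereal (\<phi> x) + (1 - t) * real_of_ereal (\<phi> y)) \<and>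
     filterlim (\<lambda>x. real_of_ereal (\<phi> x) / x) at_top at_top"

(* phi-divergence D_phi(Q||P) = E^P[phi(dQ/dP)] (positive part minus negative part) *)
definition phi_div :: "(real \<Rightarrow> ereal) \<Rightarrow> 'a measure \<Rightarrow> 'a measure \<Rightarrow> ereal" where
  "phi_div \<phi> Q P =
     enn2ereal (\<integral>\<^sup>+ \<omega>. e2ennreal (\<phi> (enn2real (RN_deriv P Q \<omega>))) \<partial>P)
     - enn2ereal (\<integral>\<^sup>+ \<omega>. e2ennreal (- \<phi> (enn2real (RN_deriv P Q \<omega>))) \<partial>P)"

definition P_phi :: "'a measure \<Rightarrow> (real \<Rightarrow> ereal) \<Rightarrow> real \<Rightarrow> 'a measure set" where
  "P_phi P \<phi> \<delta> = {Q. prob_space Q \<and> sets Q = sets P \<and> absolutely_continuous P Q \<and>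
                        phi_div \<phi> Q P \<le> ereal \<delta>}"

definition g_phi :: "(real \<Rightarrow> ereal) \<Rightarrow> real \<Rightarrow> real \<Rightarrow> real" where
  "g_phi \<phi> \<delta> x =
     (if x = 0 then 0 else if x = 1 then 1 else
      Sup {t. x \<le> t \<and> t \<le> 1 \<and>
              ereal x * \<phi> (t / x) + ereal (1 - x) * \<phi> ((1 - t) / (1 - x)) \<le> ereal \<delta>})"

(* inverse of g_phi restricted to [0, x_delta]: the unique x in [0,1] with g x = y (for y in [0,1)) *)
definition g_phi_inv :: "(real \<Rightarrow> ereal) \<Rightarrow> real \<Rightarrow> real \<Rightarrow> real" where
  "g_phi_inv \<phi> \<delta> y = (THE x. 0 \<le> x \<and> x \<le> 1 \<and> g_phi \<phi> \<delta> x = y)"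

end

theory Submission
  imports Defs
begin

text \<open>
  For an event \<open>A\<close> with \<open>0 < P A < 1\<close>, Jensen's inequality on \<open>A\<close> and on its complement shows that
  \<open>Q A = t\<close> is possible in the divergence ball only if the divergence of the Bernoulli law with
  parameter \<open>t\<close> from the one with parameter \<open>P A\<close> is at most \<open>\<delta>\<close>; a density that is constant on \<open>A\<close>
  and on its complement shows the converse. Hence \<open>g (P A)\<close> is the supremum of \<open>Q A\<close> over the ball.
  As \<open>\<Lambda>\<close> is increasing, the sets \<open>{x. Q (X > x) \<le> \<Lambda> x}\<close> are closed upwards, so the supremum of their
  infima is the infimum of their intersection.

  The Bernoulli divergence is jointly convex in its two parameters and vanishes on the diagonal. For
  \<open>p \<le> y < 1\<close> this makes \<open>g p \<le> y\<close> equivalent to \<open>\<delta> \<le> bern_div p y\<close>, a condition that is decreasing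
  in \<open>p\<close>; superlinearity provides a \<open>p\<close> with equality, which is the inverse of \<open>g\<close> at \<open>y\<close>. Strict
  convexity makes \<open>bern_div p y\<close> positive for \<open>p < y\<close>, so \<open>g p \<le> y\<close> once \<open>\<delta>\<close> is small, while \<open>g p > p\<close>
  for every \<open>\<delta> > 0\<close>: this gives the limit.
\<close>

section \<open>Extended-valued convex functions: effective domain, supporting lines,
  measurability\<close>

lemma phi_admissibleD:
  assumes "phi_admissible \<phi>"
  shows "0 \<le> x \<Longrightarrow> \<phi> x \<noteq> -\<infinity>"
    and "0 \<le> x \<Longrightarrow> 0 \<le> y \<Longrightarrow> 0 \<le> t \<Longrightarrow> t \<le> 1 \<Longrightarrow>
           \<phi> (t * x + (1 - t) * y) \<le> ereal t * \<phi> x + ereal (1 - t) * \<phi> y"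
    and "\<phi> 1 = 0"
  using assms unfolding phi_admissible_def by blast+

lemma phi_finite_eq_ereal:
  assumes "phi_admissible \<phi>" "0 \<le> x" "\<phi> x \<noteq> \<infinity>"
  shows "\<phi> x = ereal (real_of_ereal (\<phi> x))"
  using assms phi_admissibleD(1)[OF assms(1,2)] by (cases "\<phi> x") auto

text \<open>Passing to real values on the effective domain makes the theory of real convex functions
  applicable to an extended-valued \<open>\<phi>\<close>.\<close>

lemma phi_convex_on_domain:
  assumes "phi_admissible \<phi>"
  shows "convex_on {x. 0 \<le> x \<and> \<phi> x \<noteq> \<infinity>} (\<lambda>x. real_of_ereal (\<phi> x))"
proof -
  have conv: "\<phi> ((1 - t) * x + t * y) \<le>
      ereal ((1 - t) * real_of_ereal (\<phi> x) + t * real_of_ereal (\<phi> y))"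
    if *: "0 \<le> t" "t \<le> 1" "0 \<le> x" "0 \<le> y" "\<phi> x \<noteq> \<infinity>" "\<phi> y \<noteq> \<infinity>" for t x y
  proof -
    obtain a b where "\<phi> x = ereal a" "\<phi> y = ereal b"
      using phi_finite_eq_ereal[OF assms *(3,5)] phi_finite_eq_ereal[OF assms *(4,6)] by blast
    moreover have "\<phi> ((1 - t) * x + (1 - (1 - t)) * y) \<le> ereal (1 - t) * \<phi> x + ereal (1 - (1 - t)) * \<phi> y"
      using * by (intro phi_admissibleD(2)[OF assms]) auto
    ultimately show ?thesis by simp
  qed
  show ?thesis
  proof (rule convex_onI)
    show "convex {x. 0 \<le> x \<and> \<phi> x \<noteq> \<infinity>}"
      unfolding convex_alt
    proof safe
      fix x y u :: real
      assume *: "0 \<le> x" "\<phi> x \<noteq> \<infinity>" "0 \<le> y" "\<phi> y \<noteq> \<infinity>" "0 \<le> u" "u \<le> 1"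
      then show "0 \<le> (1 - u) *\<^sub>R x + u *\<^sub>R y" by simp
      assume "\<phi> ((1 - u) *\<^sub>R x + u *\<^sub>R y) = \<infinity>"
      then show False using conv[of u x y] * by simp
    qed
  next
    fix t x y :: real
    assume *: "0 < t" "t < 1" "x \<in> {x. 0 \<le> x \<and> \<phi> x \<noteq> \<infinity>}" "y \<in> {x. 0 \<le> x \<and> \<phi> x \<noteq> \<infinity>}"
    then have nn: "0 \<le> (1 - t) * x + t * y" by simp
    have le: "\<phi> ((1 - t) * x + t * y) \<le>
      ereal ((1 - t) * real_of_ereal (\<phi> x) + t * real_of_ereal (\<phi> y))"
      using conv[of t x y] * by simp
    then have "\<phi> ((1 - t) * x + t * y) \<noteq> \<infinity>" by auto
    then obtain c where "\<phi> ((1 - t) * x + t * y) = ereal c"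
      using phi_finite_eq_ereal[OF assms nn] by blast
    with le show "real_of_ereal (\<phi> ((1 - t) *\<^sub>R x + t *\<^sub>R y))
       \<le> (1 - t) * real_of_ereal (\<phi> x) + t * real_of_ereal (\<phi> y)"
      by simp
  qed
qed

text \<open>Finite values at \<open>l\<close> and \<open>u\<close> put \<open>m\<close> in the
  interior of the effective domain, where a convex function has a supporting line; outside the
  domain the bound is trivial.\<close>

lemma phi_subgradient:
  assumes "phi_admissible \<phi>" "0 \<le> l" "l < m" "m < u" "\<phi> l \<noteq> \<infinity>" "\<phi> u \<noteq> \<infinity>"
  obtains a c where "\<phi> m = ereal c" "\<And>z. 0 \<le> z \<Longrightarrow> ereal (c + a * (z - m)) \<le> \<phi> z"
proof -
  let ?D = "{x. 0 \<le> x \<and> \<phi> x \<noteq> \<infinity>}"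
  let ?f = "\<lambda>x. real_of_ereal (\<phi> x)"
  \<comment> \<open>By convexity this infimum of difference quotients to the right of
    \<open>m\<close> is the right derivative at \<open>m\<close>.\<close>
  define a where "a = Inf ((\<lambda>t. (?f m - ?f t) / (m - t)) ` ({m<..} \<inter> ?D))"
  have cv: "convex_on ?D ?f" by (rule phi_convex_on_domain[OF assms(1)])
  have D: "{l..u} \<subseteq> ?D"
    using convex_on_imp_convex[OF cv] assms
      mem_is_interval_1_I[of ?D l u] by (auto simp: is_interval_convex_1)
  have "{l<..<u} \<subseteq> ?D" using D by (auto simp: subset_iff)
  then have m: "m \<in> interior ?D"
    using assms by (intro interiorI[of "{l<..<u}"]) auto
  then have "m \<in> ?D" using interior_subset by blast
  then have mm: "\<phi> m = ereal (?f m)" using phi_finite_eq_ereal[OF assms(1)] by blast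
  have "ereal (?f m + a * (z - m)) \<le> \<phi> z" if "0 \<le> z" for z
  proof (cases "\<phi> z = \<infinity>")
    case False
    then show ?thesis
      using convex_le_Inf_differential[OF cv m, of z] that phi_finite_eq_ereal[OF assms(1) that False]
      unfolding a_def[symmetric] by (metis (mono_tags, lifting) ereal_less_eq(3) mem_Collect_eq)
  qed simp
  with mm show thesis by (rule that)
qed

text \<open>A second point of the effective domain besides 1 leaves an interior point between them,
  where a supporting line exists. If 1 is the only point, the zero function lies below
  \<open>\<phi>\<close>.\<close>

lemma phi_affine_minorant:
  assumes "phi_admissible \<phi>"
  obtains a c where "\<And>z. 0 \<le> z \<Longrightarrow> ereal (c + a * z) \<le> \<phi> z"
proof (cases "\<exists>z\<ge>0. z \<noteq> 1 \<and> \<phi> z \<noteq> \<infinity>")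
  case True
  then obtain z where z: "z \<ge> 0" "z \<noteq> 1" "\<phi> z \<noteq> \<infinity>" by blast
  have 1: "\<phi> 1 \<noteq> \<infinity>" using phi_admissibleD(3)[OF assms] by simp
  have "\<exists>l m u. 0 \<le> l \<and> l < m \<and> m < u \<and> \<phi> l \<noteq> \<infinity> \<and> \<phi> u \<noteq> \<infinity>"
  proof (cases "z < 1")
    case True
    then obtain m where "z < m" "m < 1" using dense by blast
    then show ?thesis using z 1 by blast
  next
    case False
    then have "1 < z" using z by simp
    then obtain m where "1 < m" "m < z" using dense by blast
    then show ?thesis using z 1 by (meson zero_le_one)
  qed
  then obtain l m u where "0 \<le> l" "l < m" "m < u" "\<phi> l \<noteq> \<infinity>" "\<phi> u \<noteq> \<infinity>" by blast
  from phi_subgradient[OF assms this] obtain a c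
    where "\<And>z. 0 \<le> z \<Longrightarrow> ereal (c + a * (z - m)) \<le> \<phi> z" by metis
  then have "\<And>z. 0 \<le> z \<Longrightarrow> ereal ((c - a * m) + a * z) \<le> \<phi> z"
    by (simp add: algebra_simps)
  then show thesis by (rule that)
next
  case False
  then have "\<And>z. 0 \<le> z \<Longrightarrow> ereal (0 + 0 * z) \<le> \<phi> z"
    using phi_admissibleD(3)[OF assms] by (metis ereal_less_eq(1) mult_zero_left add_0 order_refl zero_ereal_def)
  then show thesis by (rule that)
qed

text \<open>Convexity makes the sublevel sets intervals. The argument is clipped by
  \<open>max 0\<close> because admissibility does not restrict \<open>\<phi>\<close> on negative
  numbers.\<close>

lemma phi_borel_measurable:
  assumes "phi_admissible \<phi>"
  shows "(\<lambda>x. \<phi> (max 0 x)) \<in> borel_measurable borel"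
proof (rule borel_measurableI_le)
  fix c
  have "is_interval ({0..} \<inter> {x. \<phi> x \<le> c})"
    unfolding is_interval_1
  proof safe
    fix x y z
    assume *: "\<phi> x \<le> c" "\<phi> y \<le> c" "0 \<le> x" "x \<le> z" "z \<le> y"
    show "z \<ge> 0" using * by simp
    show "\<phi> z \<le> c"
    proof (cases "x = y")
      case True
      with * have "z = x" by simp
      with * show ?thesis by simp
    next
      case False
      define t where "t = (y - z) / (y - x)"
      have t: "0 \<le> t" "t \<le> 1" using * False by (auto simp: t_def divide_simps)
      have "t * (y - x) = y - z" using False by (simp add: t_def)
      then have z: "z = t * x + (1 - t) * y" by (simp add: algebra_simps)
      have "\<phi> z \<le> ereal t * \<phi> x + ereal (1 - t) * \<phi> y"
        unfolding z using * t by (intro phi_admissibleD(2)[OF assms]) auto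
      also have "\<dots> \<le> ereal t * c + ereal (1 - t) * c"
        using * t by (intro add_mono ereal_mult_left_mono) auto
      also have "\<dots> = c"
        using t by (simp flip: ereal_left_distrib)
      finally show ?thesis .
    qed
  qed
  then have m: "{0..} \<inter> {x. \<phi> x \<le> c} \<in> sets borel" by (rule real_interval_borel_measurable)
  have "{x \<in> space borel. \<phi> (max 0 x) \<le> c} =
      ({0..} \<inter> {x. \<phi> x \<le> c}) \<union> (if \<phi> 0 \<le> c then {..0} else {})"
    by (auto simp: max_def split: if_splits)
  then show "{x \<in> space borel. \<phi> (max 0 x) \<le> c} \<in> sets borel" using m by auto
qed

section \<open>Event probabilities over the divergence ball\<close>

text \<open>Integrability of \<open>r\<close> makes both nonnegative integrals in
  \<open>phi_div\<close> finite, so their extended difference is an ordinary integral.\<close>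

lemma phi_div_eq_integral:
  assumes "AE \<omega> in P. \<phi> (enn2real (RN_deriv P Q \<omega>)) = ereal (r \<omega>)" "integrable P r"
  shows "phi_div \<phi> Q P = ereal (\<integral>\<omega>. r \<omega> \<partial>P)"
proof -
  have 1: "(\<integral>\<^sup>+ \<omega>. e2ennreal (\<phi> (enn2real (RN_deriv P Q \<omega>))) \<partial>P) = (\<integral>\<^sup>+ \<omega>. ennreal (r \<omega>) \<partial>P)"
    by (rule nn_integral_cong_AE) (use assms(1) in \<open>auto elim!: eventually_mono\<close>)
  have 2: "(\<integral>\<^sup>+ \<omega>. e2ennreal (- \<phi> (enn2real (RN_deriv P Q \<omega>))) \<partial>P) = (\<integral>\<^sup>+ \<omega>. ennreal (- r \<omega>) \<partial>P)"
    by (rule nn_integral_cong_AE) (use assms(1) in \<open>auto elim!: eventually_mono\<close>)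
  have fin: "enn2ereal x = ereal (enn2real x)" if "x \<noteq> \<infinity>" for x
    using that by (cases x) (auto simp: enn2ereal_ennreal)
  show ?thesis
    using assms(2) unfolding phi_div_def 1 2 real_lebesgue_integral_def[OF assms(2)] real_integrable_def
    by (simp add: fin)
qed

text \<open>Jensen's inequality for the conditional law on \<open>A\<close>. A supporting line at
  the conditional mean \<open>m\<close> integrates to the claim; since \<open>\<phi>\<close> may be
  infinite, \<open>m\<close> can also fail to be interior to the effective domain, which is treated
  separately.\<close>

lemma phi_jensen_on_event:
  assumes "prob_space P" and \<phi>: "phi_admissible \<phi>" and A: "A \<in> sets P" "0 < measure P A"
    and Z: "integrable P Z" "\<And>\<omega>. 0 \<le> Z \<omega>"
    and r: "integrable P r" "AE \<omega> in P. \<phi> (Z \<omega>) = ereal (r \<omega>)"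
  shows "ereal (measure P A) * \<phi> ((\<integral>\<omega>. indicator A \<omega> * Z \<omega> \<partial>P) / measure P A)
           \<le> ereal (\<integral>\<omega>. indicator A \<omega> * r \<omega> \<partial>P)"
proof -
  interpret prob_space P by fact
  define p where "p = measure P A"
  define m where "m = (\<integral>\<omega>. indicator A \<omega> * Z \<omega> \<partial>P) / p"
  have p: "0 < p" using A by (simp add: p_def)
  have iZ: "integrable P (\<lambda>\<omega>. indicator A \<omega> * Z \<omega>)" and ir: "integrable P (\<lambda>\<omega>. indicator A \<omega> * r \<omega>)"
    and i1: "integrable P (\<lambda>\<omega>. indicator A \<omega> :: real)"
    using A Z r by (auto intro!: integrable_real_mult_indicator simp: mult.commute[of "indicator A _"]
       less_top[symmetric])
  have intZ: "(\<integral>\<omega>. indicator A \<omega> * Z \<omega> \<partial>P) = p * m" using p by (simp add: m_def)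
  have int1: "(\<integral>\<omega>. indicator A \<omega> \<partial>P) = p" using A by (simp add: p_def)
  have intd: "(\<integral>\<omega>. indicator A \<omega> * (Z \<omega> - m) \<partial>P) = 0"
    using intZ int1 iZ i1 by (simp add: right_diff_distrib)
  have id: "integrable P (\<lambda>\<omega>. indicator A \<omega> * (Z \<omega> - m))"
    using iZ i1 by (simp add: right_diff_distrib)
  have m0: "0 \<le> m" using p Z by (auto simp: m_def intro!: divide_nonneg_pos integral_nonneg_AE)
  \<comment> \<open>If the mean on \<open>A\<close> is not interior to the domain, then \<open>Z\<close> stays on one side of its mean, hence is a.e. constant on \<open>A\<close>.\<close>
  have degenerate: ?thesis
    if s: "s \<noteq> 0" and sgn: "AE \<omega> in P. 0 \<le> s * (Z \<omega> - m)" for s :: real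
  proof -
    have "AE \<omega> in P. s * (indicator A \<omega> * (Z \<omega> - m)) = 0"
    proof (subst integral_nonneg_eq_0_iff_AE[symmetric])
      show "AE \<omega> in P. 0 \<le> s * (indicator A \<omega> * (Z \<omega> - m))"
        using sgn by eventually_elim (auto simp: indicator_def)
    qed (use id intd in auto)
    with r(2) have eq: "AE \<omega> in P. \<omega> \<in> A \<longrightarrow> \<phi> m = ereal (r \<omega>)"
      by eventually_elim (use s in \<open>auto simp: indicator_def\<close>)
    \<comment> \<open>\<open>r\<close> is real-valued, so an infinite \<open>\<phi> m\<close> would
      make \<open>A\<close> a null set.\<close>
    have "\<exists>c. \<phi> m = ereal c"
    proof (rule ccontr)
      assume "\<nexists>c. \<phi> m = ereal c"
      with eq have "AE \<omega> in P. \<omega> \<notin> A" by (auto elim!: eventually_mono)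
      then show False using A AE_iff_measurable[of A P "\<lambda>\<omega>. \<omega> \<notin> A"] sets.sets_into_space
        by (auto simp: measure_def Collect_conj_eq)
    qed
    then obtain c where c: "\<phi> m = ereal c" by blast
    with eq have "AE \<omega> in P. indicator A \<omega> * r \<omega> = indicator A \<omega> * c"
      by (auto elim!: eventually_mono)
    then have "(\<integral>\<omega>. indicator A \<omega> * r \<omega> \<partial>P) = (\<integral>\<omega>. indicator A \<omega> * c \<partial>P)"
      using A r by (intro integral_cong_AE) auto
    then show ?thesis using c int1 by (simp add: m_def[symmetric] p_def[symmetric])
  qed
  \<comment> \<open>Either the effective domain has points strictly on both sides of
    \<open>m\<close>, or one side has none, and then a.e. finiteness of
    \<open>\<phi> (Z \<omega>)\<close> keeps \<open>Z\<close> off that side.\<close>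
  consider (int) l u where "0 \<le> l" "l < m" "m < u" "\<phi> l \<noteq> \<infinity>" "\<phi> u \<noteq> \<infinity>"
    | (left) "\<And>z. 0 \<le> z \<Longrightarrow> z < m \<Longrightarrow> \<phi> z = \<infinity>" | (right) "\<And>z. m < z \<Longrightarrow> \<phi> z = \<infinity>"
    by metis
  then show ?thesis
  proof cases
    case int
    from phi_subgradient[OF \<phi> this] obtain a c where c: "\<phi> m = ereal c"
      and a: "\<And>z. 0 \<le> z \<Longrightarrow> ereal (c + a * (z - m)) \<le> \<phi> z" by metis
    have "p * c = (\<integral>\<omega>. indicator A \<omega> * c + a * (indicator A \<omega> * (Z \<omega> - m)) \<partial>P)"
      using int1 id i1 intd by simp
    also have "\<dots> \<le> (\<integral>\<omega>. indicator A \<omega> * r \<omega> \<partial>P)"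
    proof (rule integral_mono_AE)
      show "AE \<omega> in P. indicator A \<omega> * c + a * (indicator A \<omega> * (Z \<omega> - m)) \<le> indicator A \<omega> * r \<omega>"
        using r(2)
      proof eventually_elim
        case (elim \<omega>)
        then show ?case using a[OF Z(2), of \<omega>] by (auto simp: indicator_def)
      qed
    qed (use id i1 ir in auto)
    finally show ?thesis using c by (simp add: m_def[symmetric] p_def[symmetric])
  next
    case left
    have "AE \<omega> in P. 0 \<le> 1 * (Z \<omega> - m)"
      using r(2)
    proof eventually_elim
      case (elim \<omega>)
      then show ?case using left[OF Z(2), of \<omega>] by (cases "Z \<omega> < m") auto
    qed
    from degenerate[OF _ this] show ?thesis by simp
  next
    case right
    have "AE \<omega> in P. 0 \<le> (-1) * (Z \<omega> - m)"
      using r(2)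
    proof eventually_elim
      case (elim \<omega>)
      then show ?case using right[of "Z \<omega>"] by (cases "m < Z \<omega>") auto
    qed
    from degenerate[OF _ this] show ?thesis by simp
  qed
qed

text \<open>Data processing for the partition into \<open>A\<close> and its complement: Jensen's
  inequality for the density on both parts, added up, bounds the left side by the
  divergence.\<close>

lemma phi_ball_event_bound:
  assumes "prob_space P" and \<phi>: "phi_admissible \<phi>" and Q: "Q \<in> P_phi P \<phi> \<delta>"
    and A: "A \<in> sets P" "0 < measure P A" "measure P A < 1"
  shows "ereal (measure P A) * \<phi> (measure Q A / measure P A)
           + ereal (1 - measure P A) * \<phi> ((1 - measure Q A) / (1 - measure P A)) \<le> ereal \<delta>"
proof -
  interpret prob_space P by fact
  have sQ [measurable_cong]: "sets Q = sets P" and ac: "absolutely_continuous P Q"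
    and div: "phi_div \<phi> Q P \<le> ereal \<delta>" and "prob_space Q"
    using Q by (auto simp: P_phi_def)
  interpret Q: prob_space Q by fact
  define Z where "Z \<omega> = enn2real (RN_deriv P Q \<omega>)" for \<omega>
  have Zm [measurable]: "Z \<in> borel_measurable P" unfolding Z_def by measurable
  have Z0: "0 \<le> Z \<omega>" for \<omega> by (simp add: Z_def)
  have "AE \<omega> in P. RN_deriv P Q \<omega> \<noteq> \<infinity>"
    by (rule RN_deriv_finite[OF Q.sigma_finite_measure_axioms ac sQ])
  then have RN: "AE \<omega> in P. RN_deriv P Q \<omega> = ennreal (Z \<omega>)"
    by eventually_elim (simp add: Z_def ennreal_enn2real_if)
  have nnZ: "(\<integral>\<^sup>+ \<omega>. ennreal (indicator B \<omega> * Z \<omega>) \<partial>P) = ennreal (measure Q B)" if B: "B \<in> sets P" for B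
  proof -
    have "ennreal (measure Q B) = emeasure (density P (RN_deriv P Q)) B"
      by (simp add: density_RN_deriv[OF ac sQ] Q.emeasure_eq_measure)
    also have "\<dots> = (\<integral>\<^sup>+ \<omega>. RN_deriv P Q \<omega> * indicator B \<omega> \<partial>P)"
      using B by (simp add: emeasure_density)
    also have "\<dots> = (\<integral>\<^sup>+ \<omega>. ennreal (indicator B \<omega> * Z \<omega>) \<partial>P)"
      by (rule nn_integral_cong_AE) (use RN in \<open>auto simp: indicator_def elim!: eventually_mono\<close>)
    finally show ?thesis by simp
  qed
  have intZ: "(\<integral>\<omega>. indicator B \<omega> * Z \<omega> \<partial>P) = measure Q B" if B: "B \<in> sets P" for B
    using nnZ[OF B] B Z0 by (subst integral_eq_nn_integral) auto
  have iZ: "integrable P Z"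
  proof (rule integrableI_nn_integral_finite)
    have "(\<integral>\<^sup>+ \<omega>. ennreal (Z \<omega>) \<partial>P) = (\<integral>\<^sup>+ \<omega>. ennreal (indicator (space P) \<omega> * Z \<omega>) \<partial>P)"
      by (rule nn_integral_cong) simp
    then show "(\<integral>\<^sup>+ \<omega>. ennreal (Z \<omega>) \<partial>P) = ennreal (measure Q (space P))"
      using nnZ[OF sets.top] by simp
  qed (use Z0 in auto)
  define r where "r \<omega> = real_of_ereal (\<phi> (Z \<omega>))" for \<omega>
  have "(\<lambda>\<omega>. \<phi> (max 0 (Z \<omega>))) \<in> borel_measurable P"
    using measurable_compose[OF Zm phi_borel_measurable[OF \<phi>]] .
  then have \<phi>Z [measurable]: "(\<lambda>\<omega>. \<phi> (Z \<omega>)) \<in> borel_measurable P" using Z0 by (simp add: max_def)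
  \<comment> \<open>In \<open>ereal\<close> the difference of two infinities is
    \<open>\<infinity>\<close>, so a divergence of at most \<open>\<delta>\<close> forces the
    positive part to be finite.\<close>
  have pos: "(\<integral>\<^sup>+ \<omega>. e2ennreal (\<phi> (Z \<omega>)) \<partial>P) \<noteq> \<infinity>"
    using div unfolding phi_div_def Z_def[symmetric] by auto
  have "AE \<omega> in P. e2ennreal (\<phi> (Z \<omega>)) \<noteq> \<infinity>"
    by (rule nn_integral_PInf_AE[OF _ pos]) measurable
  then have rZ: "AE \<omega> in P. \<phi> (Z \<omega>) = ereal (r \<omega>)"
    unfolding r_def
    by eventually_elim (auto intro!: phi_finite_eq_ereal[OF \<phi> Z0])
  have ir: "integrable P r"
    unfolding real_integrable_def
  proof safe
    show "r \<in> borel_measurable P" unfolding r_def by measurable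
  next
    assume "(\<integral>\<^sup>+ \<omega>. ennreal (r \<omega>) \<partial>P) = \<infinity>"
    moreover have "(\<integral>\<^sup>+ \<omega>. ennreal (r \<omega>) \<partial>P) = (\<integral>\<^sup>+ \<omega>. e2ennreal (\<phi> (Z \<omega>)) \<partial>P)"
      by (rule nn_integral_cong_AE) (use rZ in \<open>auto elim!: eventually_mono\<close>)
    ultimately show False using pos by simp
  next
    \<comment> \<open>An affine minorant bounds the negative part by that of an affine function of
      \<open>Z\<close>, which is integrable.\<close>
    assume inf: "(\<integral>\<^sup>+ \<omega>. ennreal (- r \<omega>) \<partial>P) = \<infinity>"
    obtain a c where ac: "\<And>z. 0 \<le> z \<Longrightarrow> ereal (c + a * z) \<le> \<phi> z"
      using phi_affine_minorant[OF \<phi>] by metis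
    have "(\<integral>\<^sup>+ \<omega>. ennreal (- r \<omega>) \<partial>P) \<le> (\<integral>\<^sup>+ \<omega>. ennreal (- (c + a * Z \<omega>)) \<partial>P)"
    proof (rule nn_integral_mono_AE)
      show "AE \<omega> in P. ennreal (- r \<omega>) \<le> ennreal (- (c + a * Z \<omega>))"
        using rZ
      proof eventually_elim
        case (elim \<omega>)
        then show ?case using ac[OF Z0, of \<omega>] by (auto intro!: ennreal_leI)
      qed
    qed
    moreover have "integrable P (\<lambda>\<omega>. c + a * Z \<omega>)" using iZ by simp
    ultimately show False using inf by (auto simp: real_integrable_def top_unique)
  qed
  have D: "(\<integral>\<omega>. r \<omega> \<partial>P) \<le> \<delta>"
    using div phi_div_eq_integral[OF rZ[unfolded Z_def] ir] by simp
  let ?B = "space P - A"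
  have mB: "measure P ?B = 1 - measure P A" "measure Q ?B = 1 - measure Q A"
    using A prob_compl Q.prob_compl[of A] sQ sets_eq_imp_space_eq[OF sQ] by auto
  have B: "?B \<in> sets P" "0 < measure P ?B" using A mB by auto
  have "ereal (measure P A) * \<phi> (measure Q A / measure P A)
           + ereal (1 - measure P A) * \<phi> ((1 - measure Q A) / (1 - measure P A))
     \<le> ereal (\<integral>\<omega>. indicator A \<omega> * r \<omega> \<partial>P) + ereal (\<integral>\<omega>. indicator ?B \<omega> * r \<omega> \<partial>P)"
    using phi_jensen_on_event[OF assms(1) \<phi> A(1,2) iZ Z0 ir rZ]
      phi_jensen_on_event[OF assms(1) \<phi> B iZ Z0 ir rZ]
    by (intro add_mono) (auto simp: intZ A B mB)
  also have "\<dots> = ereal (\<integral>\<omega>. indicator A \<omega> * r \<omega> + indicator ?B \<omega> * r \<omega> \<partial>P)"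
    using A B ir by (auto simp: mult.commute[of "indicator _ _"] integrable_real_mult_indicator)
  also have "(\<integral>\<omega>. indicator A \<omega> * r \<omega> + indicator ?B \<omega> * r \<omega> \<partial>P) = (\<integral>\<omega>. r \<omega> \<partial>P)"
    by (rule Bochner_Integration.integral_cong) (auto simp: indicator_def)
  finally show ?thesis using D by (meson ereal_less_eq(3) order_trans)
qed

text \<open>The density \<open>t / p\<close> on \<open>A\<close> and
  \<open>(1 - t) / (1 - p)\<close> off it, with \<open>p = measure P A\<close>, turns the event
  bound into an equality.\<close>

lemma phi_ball_two_valued:
  assumes "prob_space P" and \<phi>: "phi_admissible \<phi>"
    and A: "A \<in> sets P" "0 < measure P A" "measure P A < 1" and t: "0 \<le> t" "t \<le> 1"
    and le: "ereal (measure P A) * \<phi> (t / measure P A)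
           + ereal (1 - measure P A) * \<phi> ((1 - t) / (1 - measure P A)) \<le> ereal \<delta>"
  obtains Q where "Q \<in> P_phi P \<phi> \<delta>" "measure Q A = t"
proof -
  interpret prob_space P by fact
  define p where "p = measure P A"
  have p: "0 < p" "p < 1" using A by (auto simp: p_def)
  let ?B = "space P - A"
  have mB: "measure P ?B = 1 - p" using A prob_compl by (simp add: p_def)
  \<comment> \<open>Neither summand of \<open>le\<close> can be \<open>-\<infinity>\<close>, so an
    infinite value would make the whole sum infinite.\<close>
  have fin: "\<phi> (t / p) \<noteq> \<infinity>" "\<phi> ((1 - t) / (1 - p)) \<noteq> \<infinity>"
    using le p t phi_admissibleD(1)[OF \<phi>, of "t / p"] phi_admissibleD(1)[OF \<phi>, of "(1 - t) / (1 - p)"]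
    unfolding p_def[symmetric]
    by (auto simp: ereal_mult_eq_MInfty)
  define a b where "a = real_of_ereal (\<phi> (t / p))" and "b = real_of_ereal (\<phi> ((1 - t) / (1 - p)))"
  have ab: "\<phi> (t / p) = ereal a" "\<phi> ((1 - t) / (1 - p)) = ereal b"
    unfolding a_def b_def using fin p t by (auto intro!: phi_finite_eq_ereal[OF \<phi>])
  define f where "f \<omega> = (if \<omega> \<in> A then t / p else (1 - t) / (1 - p))" for \<omega>
  have fm [measurable]: "f \<in> borel_measurable P" unfolding f_def using A by measurable
  have f0: "0 \<le> f \<omega>" for \<omega> using p t by (auto simp: f_def)
  define Q where "Q = density P (\<lambda>\<omega>. ennreal (f \<omega>))"
  have two: "integrable P (\<lambda>\<omega>. indicator A \<omega> * x + indicator ?B \<omega> * y)"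
    "(\<integral>\<omega>. indicator A \<omega> * x + indicator ?B \<omega> * y \<partial>P) = p * x + (1 - p) * y" for x y :: real
    using A mB by (auto simp: p_def less_top[symmetric])
  have two': "(\<integral>\<^sup>+\<omega>. ennreal (indicator A \<omega> * x + indicator ?B \<omega> * y) \<partial>P) = ennreal (p * x + (1 - p) * y)"
    if "0 \<le> x" "0 \<le> y" for x y :: real
    using two[of x y] that by (subst nn_integral_eq_integral) auto
  have "emeasure Q (space Q) = (\<integral>\<^sup>+\<omega>. ennreal (indicator A \<omega> * (t / p) + indicator ?B \<omega> * ((1 - t) / (1 - p))) \<partial>P)"
    unfolding Q_def using fm by (auto simp: emeasure_density f_def[abs_def] indicator_def intro!: nn_integral_cong)
  also have "\<dots> = 1"
    using p t by (subst two') auto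
  finally have Q: "prob_space Q" by (rule prob_spaceI)
  have "emeasure Q A = (\<integral>\<^sup>+\<omega>. ennreal (indicator A \<omega> * (t / p) + indicator ?B \<omega> * 0) \<partial>P)"
    unfolding Q_def using A fm by (auto simp: emeasure_density f_def[abs_def] indicator_def intro!: nn_integral_cong)
  also have "\<dots> = ennreal t"
    using p t by (subst two') auto
  finally have QA: "measure Q A = t" using t by (simp add: measure_def)
  have "AE \<omega> in P. ennreal (f \<omega>) = RN_deriv P Q \<omega>"
    by (rule RN_deriv_unique) (auto simp: Q_def)
  then have "AE \<omega> in P. \<phi> (enn2real (RN_deriv P Q \<omega>)) = ereal (indicator A \<omega> * a + indicator ?B \<omega> * b)"
    using AE_space
  proof eventually_elim
    case (elim \<omega>)
    then have "enn2real (RN_deriv P Q \<omega>) = f \<omega>" using f0 by (metis enn2real_ennreal)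
    then show ?case using elim by (auto simp: f_def ab indicator_def)
  qed
  from phi_div_eq_integral[OF this two(1)] have "phi_div \<phi> Q P \<le> ereal \<delta>"
    using le by (simp add: two ab p_def[symmetric])
  then have "Q \<in> P_phi P \<phi> \<delta>"
    using Q unfolding P_phi_def Q_def by (auto intro!: absolutely_continuousI_density)
  then show thesis using QA by (rule that)
qed

lemma self_in_P_phi:
  assumes "prob_space P" and \<phi>: "phi_admissible \<phi>" and "0 \<le> \<delta>"
  shows "P \<in> P_phi P \<phi> \<delta>"
proof -
  interpret prob_space P by fact
  have "AE \<omega> in P. 1 = RN_deriv P P \<omega>"
    by (rule RN_deriv_unique) (auto simp: density_1)
  then have "AE \<omega> in P. \<phi> (enn2real (RN_deriv P P \<omega>)) = ereal 0"
    by eventually_elim (metis enn2real_1 phi_admissibleD(3)[OF \<phi>] zero_ereal_def)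
  from phi_div_eq_integral[OF this] show ?thesis
    using assms unfolding P_phi_def by (auto simp: absolutely_continuous_def)
qed

text \<open>This says that \<open>g\<close> is the supremum of \<open>Q A\<close> over the ball,
  phrased through upper bounds so that it rewrites the condition inside \<open>LVaR\<close>.
  Absolute continuity preserves probabilities 0 and 1, which matches the special values of
  \<open>g\<close>; in between, the event bound and the two-valued densities give the two
  directions.\<close>

lemma g_phi_le_iff:
  assumes "prob_space P" and \<phi>: "phi_admissible \<phi>" and "0 \<le> \<delta>" and A: "A \<in> sets P"
  shows "g_phi \<phi> \<delta> (measure P A) \<le> c \<longleftrightarrow> (\<forall>Q\<in>P_phi P \<phi> \<delta>. measure Q A \<le> c)"
proof -
  interpret prob_space P by fact
  have P: "P \<in> P_phi P \<phi> \<delta>" by (rule self_in_P_phi) fact+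
  have null: "measure Q B = 0" if "Q \<in> P_phi P \<phi> \<delta>" "B \<in> sets P" "measure P B = 0" for Q B
  proof -
    have "B \<in> null_sets P" using that by (auto simp: null_sets_def emeasure_eq_measure)
    then have "B \<in> null_sets Q" using that by (auto simp: P_phi_def absolutely_continuous_def)
    then show ?thesis by (simp add: measure_eq_0_null_sets)
  qed
  consider "measure P A = 0" | "measure P A = 1" | "0 < measure P A" "measure P A < 1"
    using measure_nonneg[of P A] prob_le_1[of A] by linarith
  then show ?thesis
  proof cases
    case 1
    then show ?thesis using null[OF _ A] P by (auto simp: g_phi_def)
  next
    case 2
    have "measure Q A = 1" if Q: "Q \<in> P_phi P \<phi> \<delta>" for Q
    proof -
      interpret Q: prob_space Q using Q by (simp add: P_phi_def)
      have s: "sets Q = sets P" using Q by (simp add: P_phi_def)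
      have "measure Q (space P - A) = 0"
        using null[OF Q, of "space P - A"] A 2 prob_compl by simp
      then show ?thesis using Q.prob_compl[of A] A s sets_eq_imp_space_eq[OF s] by simp
    qed
    then show ?thesis using P 2 by (auto simp: g_phi_def)
  next
    case 3
    let ?p = "measure P A"
    let ?S = "{t. ?p \<le> t \<and> t \<le> 1 \<and> ereal ?p * \<phi> (t / ?p) + ereal (1 - ?p) * \<phi> ((1 - t) / (1 - ?p)) \<le> ereal \<delta>}"
    have g: "g_phi \<phi> \<delta> ?p = Sup ?S" using 3 by (simp add: g_phi_def)
    have pS: "?p \<in> ?S" using 3 phi_admissibleD(3)[OF \<phi>] \<open>0 \<le> \<delta>\<close> by (auto simp: prob_le_1)
    have bdd: "bdd_above ?S" by (rule bdd_aboveI[of _ 1]) auto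
    show ?thesis
      unfolding g
    proof safe
      fix Q assume le: "Sup ?S \<le> c" and Q: "Q \<in> P_phi P \<phi> \<delta>"
      interpret Q: prob_space Q using Q by (simp add: P_phi_def)
      have "measure Q A \<le> Sup ?S"
      proof (cases "?p \<le> measure Q A")
        case True
        then show ?thesis
          using phi_ball_event_bound[OF assms(1) \<phi> Q A 3] by (intro cSup_upper bdd) auto
      next
        \<comment> \<open>The set defining \<open>g\<close> only contains \<open>t\<close> from
          \<open>measure P A\<close> on; smaller values of \<open>Q A\<close> lie below its member
          \<open>measure P A\<close>.\<close>
        case False
        then show ?thesis using cSup_upper[OF pS bdd] by simp
      qed
      then show "measure Q A \<le> c" using le by simp
    next
      assume *: "\<forall>Q\<in>P_phi P \<phi> \<delta>. measure Q A \<le> c"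
      show "Sup ?S \<le> c"
      proof (rule cSup_least)
        fix t assume t: "t \<in> ?S"
        then have "0 \<le> t" "t \<le> 1"
          and "ereal ?p * \<phi> (t / ?p) + ereal (1 - ?p) * \<phi> ((1 - t) / (1 - ?p)) \<le> ereal \<delta>"
          using 3 by auto
        from phi_ball_two_valued[OF assms(1) \<phi> A 3 this] obtain Q
          where "Q \<in> P_phi P \<phi> \<delta>" "measure Q A = t" .
        then show "t \<le> c" using * by blast
      qed (use pS in auto)
    qed
  qed
qed

section \<open>Worst-case quantiles over the ball\<close>

text \<open>By \<open>g_phi_le_iff\<close> the levels for \<open>g\<close> are those common to all
  \<open>Q\<close>, which gives one inequality. Conversely, a real \<open>v\<close> above the
  supremum exceeds a level of every \<open>Q\<close>, and as these sets are closed upwards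
  \<open>v\<close> is common to all.\<close>

lemma SUP_LVaR_eq_LVaR_g_phi:
  assumes "prob_space P" and \<phi>: "phi_admissible \<phi>" and "0 \<le> \<delta>" and "mono \<Lambda>"
    and X: "X \<in> borel_measurable P"
  shows "(SUP Q\<in>P_phi P \<phi> \<delta>. LVaR P \<Lambda> (measure Q) X) = LVaR P \<Lambda> (\<lambda>A. g_phi \<phi> \<delta> (measure P A)) X"
proof (rule antisym)
  have m: "{\<omega> \<in> space P. x < X \<omega>} \<in> sets P" for x using X by measurable
  note iff = g_phi_le_iff[OF assms(1-3) m]
  show "(SUP Q\<in>P_phi P \<phi> \<delta>. LVaR P \<Lambda> (measure Q) X) \<le> LVaR P \<Lambda> (\<lambda>A. g_phi \<phi> \<delta> (measure P A)) X"
    unfolding LVaR_def iff by (intro SUP_least Inf_superset_mono) auto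
  show "LVaR P \<Lambda> (\<lambda>A. g_phi \<phi> \<delta> (measure P A)) X \<le> (SUP Q\<in>P_phi P \<phi> \<delta>. LVaR P \<Lambda> (measure Q) X)"
  proof (rule dense_ge)
    fix y assume y: "(SUP Q\<in>P_phi P \<phi> \<delta>. LVaR P \<Lambda> (measure Q) X) < y"
    show "LVaR P \<Lambda> (\<lambda>A. g_phi \<phi> \<delta> (measure P A)) X \<le> y"
    proof (cases y)
      case (real v)
      have "measure Q {\<omega> \<in> space P. v < X \<omega>} \<le> \<Lambda> v" if Q: "Q \<in> P_phi P \<phi> \<delta>" for Q
      proof -
        interpret Q: prob_space Q using Q by (simp add: P_phi_def)
        have s: "sets Q = sets P" using Q by (simp add: P_phi_def)
        have "LVaR P \<Lambda> (measure Q) X < ereal v"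
          using y Q real by (meson SUP_upper le_less_trans)
        then obtain x where x: "x < v" "measure Q {\<omega> \<in> space P. x < X \<omega>} \<le> \<Lambda> x"
          unfolding LVaR_def Inf_less_iff by auto
        have "measure Q {\<omega> \<in> space P. v < X \<omega>} \<le> measure Q {\<omega> \<in> space P. x < X \<omega>}"
          using m x s by (intro Q.finite_measure_mono) auto
        also have "\<dots> \<le> \<Lambda> v" using x monoD[OF \<open>mono \<Lambda>\<close>, of x v] by simp
        finally show ?thesis .
      qed
      then show ?thesis unfolding LVaR_def iff real by (intro Inf_lower) auto
    qed (use y in auto)
  qed
qed

section \<open>Bernoulli divergences of a real convex function\<close>

text \<open>The divergence of the Bernoulli law with parameter \<open>t\<close> from the one with parameter \<open>p\<close>.\<close>

definition bern_div :: "(real \<Rightarrow> real) \<Rightarrow> real \<Rightarrow> real \<Rightarrow> real" where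
  "bern_div f p t = p * f (t / p) + (1 - p) * f ((1 - t) / (1 - p))"

text \<open>The perspective of a convex function is jointly convex: the ratio of two mixtures is
  itself a mixture of the ratios \<open>t / x\<close> and \<open>t' / x'\<close>.\<close>

lemma perspective_convex:
  fixes f :: "real \<Rightarrow> real"
  assumes f: "convex_on {0..} f" and x: "0 < x" "0 < x'" and t: "0 \<le> t" "0 \<le> t'" and s: "0 \<le> s" "s \<le> 1"
  shows "((1 - s) * x + s * x') * f (((1 - s) * t + s * t') / ((1 - s) * x + s * x'))
           \<le> (1 - s) * (x * f (t / x)) + s * (x' * f (t' / x'))"
proof -
  define X where "X = (1 - s) * x + s * x'"
  have X: "0 < X"
    using x s by (cases "s = 0") (auto simp: X_def intro!: add_nonneg_pos)
  \<comment> \<open>\<open>u\<close> is the share of \<open>x'\<close> in the mixed denominator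
    \<open>X\<close>.\<close>
  define u where "u = s * x' / X"
  have u: "0 \<le> u" "X * u = s * x'" "X * (1 - u) = (1 - s) * x"
    using s x X by (auto simp: u_def X_def field_simps)
  have "0 \<le> X * (1 - u)" using u(3) s x by simp
  then have u1: "u \<le> 1" using X by (simp add: zero_le_mult_iff)
  have "X * ((1 - u) * (t / x) + u * (t' / x')) = (X * (1 - u)) * (t / x) + (X * u) * (t' / x')"
    by (simp only: distrib_left mult.assoc)
  also have "\<dots> = (1 - s) * t + s * t'" using x unfolding u by simp
  finally have "((1 - s) * t + s * t') / X = (1 - u) * (t / x) + u * (t' / x')"
    using X by (simp add: field_simps)
  then have "X * f (((1 - s) * t + s * t') / X) \<le> X * ((1 - u) * f (t / x) + u * f (t' / x'))"
    using convex_onD[OF f u(1) u1, of "t / x" "t' / x'"] x t X by simp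
  also have "\<dots> = (X * (1 - u)) * f (t / x) + (X * u) * f (t' / x')"
    by (simp add: algebra_simps)
  also have "\<dots> = (1 - s) * (x * f (t / x)) + s * (x' * f (t' / x'))"
    unfolding u by simp
  finally show ?thesis unfolding X_def .
qed

text \<open>A sum of two perspectives. The joint form serves twice: with \<open>p\<close> fixed for
  the sublevel sets, and with \<open>t\<close> fixed for monotonicity in \<open>p\<close>.\<close>

lemma bern_div_convex:
  assumes f: "convex_on {0..} f" and "0 < p" "p < 1" "0 < p'" "p' < 1" "0 \<le> t" "t \<le> 1" "0 \<le> t'" "t' \<le> 1"
    and s: "0 \<le> s" "s \<le> 1"
  shows "bern_div f ((1 - s) * p + s * p') ((1 - s) * t + s * t') \<le> (1 - s) * bern_div f p t + s * bern_div f p' t'"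
proof -
  have eq: "1 - ((1 - s) * a + s * b) = (1 - s) * (1 - a) + s * (1 - b)" for a b
    by (simp add: algebra_simps)
  show ?thesis
    using perspective_convex[OF f, of p p' t t' s] perspective_convex[OF f, of "1 - p" "1 - p'" "1 - t" "1 - t'" s] assms
    unfolding bern_div_def eq by (simp add: algebra_simps)
qed

lemma bern_div_refl: "f 1 = 0 \<Longrightarrow> 0 < p \<Longrightarrow> p < 1 \<Longrightarrow> bern_div f p p = 0"
  by (simp add: bern_div_def)

text \<open>In its second argument the divergence is convex and vanishes at \<open>p\<close>. A
  value below \<open>\<delta>\<close> at \<open>y < 1\<close> leaves room to move right of
  \<open>y\<close>; a value of at least \<open>\<delta>\<close> at \<open>y\<close> excludes every
  larger \<open>t\<close>, as the chord from \<open>p\<close> to \<open>t\<close> would be below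
  \<open>\<delta>\<close> at \<open>y\<close>.\<close>

lemma bern_div_sublevel_Sup_le_iff:
  assumes f: "convex_on {0..} f" "f 1 = 0" and p: "0 < p" "p \<le> y" "y < 1" and \<delta>: "0 < \<delta>"
  shows "Sup {t. p \<le> t \<and> t \<le> 1 \<and> bern_div f p t \<le> \<delta>} \<le> y \<longleftrightarrow> \<delta> \<le> bern_div f p y"
proof
  let ?S = "{t. p \<le> t \<and> t \<le> 1 \<and> bern_div f p t \<le> \<delta>}"
  have pS: "p \<in> ?S" using p \<delta> bern_div_refl[of f p] f by auto
  have bdd: "bdd_above ?S" by (rule bdd_aboveI[of _ 1]) auto
  {
    assume "Sup ?S \<le> y"
    then have S: "t \<le> y" if "t \<in> ?S" for t using cSup_upper[OF that bdd] by simp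
    show "\<delta> \<le> bern_div f p y"
    proof (rule ccontr)
      assume "\<not> \<delta> \<le> bern_div f p y"
      then have less: "bern_div f p y < \<delta>" by simp
      define e where "e = \<delta> - bern_div f p y"
      \<comment> \<open>\<open>K\<close> is the size of the change between \<open>y\<close> and 1;
        by convexity, moving the fraction \<open>s\<close> of the way to 1 costs at most the slack
        \<open>e\<close>. Having \<open>e\<close> in the denominator of \<open>s\<close> covers
        \<open>K = 0\<close>.\<close>
      define K where "K = \<bar>bern_div f p 1 - bern_div f p y\<bar>"
      define s where "s = e / (e + K)"
      have e: "0 < e" "0 \<le> K" using less by (auto simp: e_def K_def)
      have s: "0 < s" "s \<le> 1" using e by (auto simp: s_def divide_simps)
      have "s * (bern_div f p 1 - bern_div f p y) \<le> s * K"
        using s by (intro mult_left_mono) (auto simp: K_def)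
      also have "\<dots> \<le> e"
      proof -
        have "e * K \<le> e * (e + K)" using e by (intro mult_left_mono) auto
        then show ?thesis using e by (simp add: s_def divide_simps mult.commute)
      qed
      finally have "(1 - s) * bern_div f p y + s * bern_div f p 1 \<le> \<delta>"
        by (simp add: e_def algebra_simps)
      moreover have "bern_div f ((1 - s) * p + s * p) ((1 - s) * y + s * 1) \<le>
          (1 - s) * bern_div f p y + s * bern_div f p 1"
        using p s by (intro bern_div_convex f) auto
      moreover have "(1 - s) * p + s * p = p" by (simp add: algebra_simps)
      ultimately have le: "bern_div f p ((1 - s) * y + s * 1) \<le> \<delta>" by simp
      have gt: "y < (1 - s) * y + s * 1"
      proof -
        have "0 < s * (1 - y)" using s p by simp
        then show ?thesis by (simp add: algebra_simps)
      qed
      have "(1 - s) * (1 - y) \<ge> 0" using s p by simp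
      then have "(1 - s) * y + s * 1 \<le> 1" by (simp add: algebra_simps)
      with le gt p have "(1 - s) * y + s * 1 \<in> ?S" by auto
      from S[OF this] gt show False by simp
    qed
  next
    assume \<delta>y: "\<delta> \<le> bern_div f p y"
    show "Sup ?S \<le> y"
    proof (rule cSup_least)
      show "?S \<noteq> {}" using pS by blast
      fix t assume t: "t \<in> ?S"
      show "t \<le> y"
      proof (rule ccontr)
        assume "\<not> t \<le> y"
        then have yt: "y < t" by simp
        have py: "p < y" using \<delta> \<delta>y p bern_div_refl[of f p] f by (cases "p = y") auto
        define s where "s = (y - p) / (t - p)"
        have s: "0 < s" "s < 1" using py yt by (auto simp: s_def divide_simps)
        have "s * (t - p) = y - p" using py yt by (simp add: s_def)
        then have "y = (1 - s) * p + s * t" by (simp add: algebra_simps)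
        moreover have "p = (1 - s) * p + s * p" by (simp add: algebra_simps)
        ultimately have "bern_div f p y = bern_div f ((1 - s) * p + s * p) ((1 - s) * p + s * t)"
          by presburger
        also have "\<dots> \<le> (1 - s) * bern_div f p p + s * bern_div f p t"
          using p s t by (intro bern_div_convex f) auto
        also have "\<dots> = s * bern_div f p t" using bern_div_refl[of f p] f p by simp
        also have "\<dots> \<le> s * \<delta>" using t s by simp
        also have "\<dots> < \<delta>" using s \<delta> by simp
        finally show False using \<delta>y by simp
      qed
    qed
  }
qed

text \<open>The parameter \<open>q\<close> lies between \<open>p\<close> and \<open>y\<close>, and
  the divergence vanishes at \<open>(y, y)\<close>, so its value at \<open>q\<close> is at most a
  fraction \<open>s < 1\<close> of the value at \<open>p\<close>.\<close>

lemma bern_div_strict_decreasing: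
  assumes f: "convex_on {0..} f" "f 1 = 0" and p: "0 < p" "p < q" "q < y" "y < 1" and pos: "0 < bern_div f q y"
  shows "bern_div f q y < bern_div f p y"
proof -
  define s where "s = (y - q) / (y - p)"
  have s: "0 < s" "s < 1" using p by (auto simp: s_def divide_simps)
  have "s * (y - p) = y - q" using p by (simp add: s_def)
  then have q: "q = (1 - s) * y + s * p" by (simp add: algebra_simps)
  have "bern_div f q y = bern_div f ((1 - s) * y + s * p) ((1 - s) * y + s * y)"
    unfolding q by (simp add: algebra_simps)
  also have "\<dots> \<le> (1 - s) * bern_div f y y + s * bern_div f p y"
    using p s by (intro bern_div_convex f) auto
  also have "\<dots> = s * bern_div f p y" using bern_div_refl[of f y] f p by simp
  finally have le: "bern_div f q y \<le> s * bern_div f p y" .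
  with pos s have "0 < bern_div f p y" by (meson less_le_trans zero_less_mult_pos)
  then have "s * bern_div f p y < 1 * bern_div f p y" using s by (intro mult_strict_right_mono)
  with le show ?thesis by simp
qed

text \<open>Strict Jensen for two distinct points whose mean with weights \<open>p\<close> and
  \<open>1 - p\<close> is 1.\<close>

lemma bern_div_pos:
  assumes strict: "\<And>x y t. 0 \<le> x \<Longrightarrow> 0 \<le> y \<Longrightarrow> x \<noteq> y \<Longrightarrow> 0 < t \<Longrightarrow> t < 1 \<Longrightarrow>
      f (t * x + (1 - t) * y) < t * f x + (1 - t) * f y"
    and "f 1 = 0" and p: "0 < p" "p < y" "y \<le> 1"
  shows "0 < bern_div f p y"
proof -
  have "y / p > 1" using p by simp
  moreover have "(1 - y) / (1 - p) < 1" using p by simp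
  ultimately have ne: "y / p \<noteq> (1 - y) / (1 - p)" by simp
  have "f (p * (y / p) + (1 - p) * ((1 - y) / (1 - p))) < bern_div f p y"
    unfolding bern_div_def using p ne by (intro strict) auto
  moreover have "p * (y / p) + (1 - p) * ((1 - y) / (1 - p)) = 1" using p by simp
  ultimately show ?thesis using \<open>f 1 = 0\<close> by simp
qed

text \<open>Intermediate values in the first argument: the divergence is 0 at \<open>y\<close>, and
  superlinearity pushes it above \<open>\<delta>\<close> at a small \<open>x0\<close>.\<close>

lemma bern_div_attains:
  assumes f: "convex_on {0..} f" "f 1 = 0" and sup: "filterlim (\<lambda>x. f x / x) at_top at_top"
    and minor: "\<And>z. 0 \<le> z \<Longrightarrow> c + a * z \<le> f z" and y: "0 < y" "y < 1" and \<delta>: "0 < \<delta>"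
  obtains x where "0 < x" "x < y" "bern_div f x y = \<delta>"
proof -
  \<comment> \<open>With \<open>x0 = y / z\<close> the first term of the divergence is
    \<open>y * (f z / z)\<close>, hence at least \<open>y * K\<close>. The extra
    \<open>\<bar>c\<bar> + \<bar>a\<bar>\<close> pays for the second term, which the affine minorant
    bounds below.\<close>
  define K where "K = (\<delta> + \<bar>c\<bar> + \<bar>a\<bar>) / y"
  have "eventually (\<lambda>z. K \<le> f z / z \<and> 1 < z) at_top"
    using sup eventually_gt_at_top[of 1] by (simp add: filterlim_at_top eventually_conj_iff)
  then obtain z where z: "K \<le> f z / z" "1 < z" by (auto simp: eventually_at_top_linorder)
  define x0 where "x0 = y / z"
  have x0: "0 < x0" "x0 < y" using y z by (auto simp: x0_def divide_simps)
  have "\<delta> + \<bar>c\<bar> + \<bar>a\<bar> = y * K" using y by (simp add: K_def)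
  also have "\<dots> \<le> y * (f z / z)" using y z by (intro mult_left_mono) auto
  also have "\<dots> = x0 * f (y / x0)" using y z by (simp add: x0_def)
  finally have 1: "\<delta> + \<bar>c\<bar> + \<bar>a\<bar> \<le> x0 * f (y / x0)" .
  have "(1 - x0) * (c + a * ((1 - y) / (1 - x0))) \<le> (1 - x0) * f ((1 - y) / (1 - x0))"
    using x0 y by (intro mult_left_mono minor) auto
  moreover have "(1 - x0) * (c + a * ((1 - y) / (1 - x0))) = (1 - x0) * c + a * (1 - y)"
    using x0 y by (simp add: distrib_left)
  moreover have "\<bar>(1 - x0) * c\<bar> \<le> 1 * \<bar>c\<bar>" "\<bar>a * (1 - y)\<bar> \<le> \<bar>a\<bar> * 1"
    unfolding abs_mult using x0 y by (intro mult_mono; simp)+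
  ultimately have "- \<bar>c\<bar> - \<bar>a\<bar> \<le> (1 - x0) * f ((1 - y) / (1 - x0))" by linarith
  with 1 have ge: "\<delta> \<le> bern_div f x0 y" by (simp add: bern_div_def)
  \<comment> \<open>Convexity gives continuity only on the open half-line; both arguments of
    \<open>f\<close> stay in it because \<open>0 < y < 1\<close>.\<close>
  have "convex_on {0<..} f" by (rule convex_on_subset[OF f(1)]) auto
  then have cont: "continuous_on {0<..} f" by (intro convex_on_continuous) auto
  have "continuous_on {x0..y} (\<lambda>x. bern_div f x y)"
    unfolding bern_div_def using x0 y
    by (intro continuous_intros continuous_on_compose2[OF cont]) auto
  with ge obtain x where x: "x0 \<le> x" "x \<le> y" "bern_div f x y = \<delta>"
    using IVT2'[of "\<lambda>x. bern_div f x y" y \<delta> x0] x0 \<delta> bern_div_refl[of f y] f y by auto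
  have "x \<noteq> y" using x \<delta> bern_div_refl[of f y] f y by auto
  with x x0 show thesis by (intro that[of x]) auto
qed

section \<open>The strictly convex, superlinear case: the inverse of \<open>g\<close> and small
  radii\<close>

context
  fixes \<phi> :: "real \<Rightarrow> ereal"
  assumes \<phi>: "phi_admissible \<phi>" and strict: "phi_strict_superlinear \<phi>"
begin

lemma phi_real_valued:
  assumes "0 \<le> x"
  obtains c where "\<phi> x = ereal c"
  using strict assms unfolding phi_strict_superlinear_def by (cases "\<phi> x") auto

lemma real_phi_convex: "convex_on {0..} (\<lambda>x. real_of_ereal (\<phi> x))"
proof -
  have "{x. 0 \<le> x \<and> \<phi> x \<noteq> \<infinity>} = {0..}"
    using strict unfolding phi_strict_superlinear_def by auto
  then show ?thesis using phi_convex_on_domain[OF \<phi>] by simp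
qed

lemma real_phi_1: "real_of_ereal (\<phi> 1) = 0"
  using phi_admissibleD(3)[OF \<phi>] by simp

abbreviation "phi_bern_div \<equiv> bern_div (\<lambda>x. real_of_ereal (\<phi> x))"

lemma phi_bern_div_pos: "0 < p \<Longrightarrow> p < y \<Longrightarrow> y \<le> 1 \<Longrightarrow> 0 < phi_bern_div p y"
  using strict unfolding phi_strict_superlinear_def by (intro bern_div_pos real_phi_1) auto

lemma g_phi_eq_Sup:
  assumes "0 < p" "p < 1"
  shows "g_phi \<phi> \<delta> p = Sup {t. p \<le> t \<and> t \<le> 1 \<and> phi_bern_div p t \<le> \<delta>}"
proof -
  have "ereal p * \<phi> (t / p) + ereal (1 - p) * \<phi> ((1 - t) / (1 - p)) = ereal (phi_bern_div p t)"
    if t: "p \<le> t" "t \<le> 1" for t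
  proof -
    have nn: "0 \<le> t / p" "0 \<le> (1 - t) / (1 - p)" using t assms by auto
    obtain a where "\<phi> (t / p) = ereal a" using nn(1) by (rule phi_real_valued)
    moreover obtain b where "\<phi> ((1 - t) / (1 - p)) = ereal b" using nn(2) by (rule phi_real_valued)
    ultimately show ?thesis by (simp add: bern_div_def)
  qed
  then show ?thesis using assms by (auto simp: g_phi_def intro!: arg_cong[of _ _ Sup])
qed

lemma g_phi_le_iff_bern_div:
  assumes "0 < p" "p \<le> y" "y < 1" "0 < \<delta>"
  shows "g_phi \<phi> \<delta> p \<le> y \<longleftrightarrow> \<delta> \<le> phi_bern_div p y"
  using assms by (simp add: g_phi_eq_Sup bern_div_sublevel_Sup_le_iff[OF real_phi_convex real_phi_1])

text \<open>The divergence vanishes on the diagonal and so stays below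
  \<open>\<delta>\<close>.\<close>

lemma g_phi_gt_self:
  assumes "0 < p" "p < 1" "0 < \<delta>"
  shows "p < g_phi \<phi> \<delta> p"
  using g_phi_le_iff_bern_div[of p p \<delta>] bern_div_refl[of "\<lambda>x. real_of_ereal (\<phi> x)" p] real_phi_1 assms by simp

text \<open>The candidate inverse is the root \<open>x\<close> of
  \<open>phi_bern_div x y = \<delta>\<close>. Monotonicity in the first argument gives the
  equivalence with \<open>x\<close>, and uniqueness of the solution of \<open>g = y\<close> then
  identifies \<open>x\<close> with the description in \<open>g_phi_inv\<close>.\<close>

lemma g_phi_le_iff_le_g_phi_inv:
  assumes y: "0 < y" "y < 1" and \<delta>: "0 < \<delta>" and p: "0 \<le> p" "p \<le> 1"
  shows "g_phi \<phi> \<delta> p \<le> y \<longleftrightarrow> p \<le> g_phi_inv \<phi> \<delta> y"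
proof -
  obtain a c where "\<And>z. 0 \<le> z \<Longrightarrow> ereal (c + a * z) \<le> \<phi> z"
    using phi_affine_minorant[OF \<phi>] by metis
  then have minor: "c + a * z \<le> real_of_ereal (\<phi> z)" if "0 \<le> z" for z
    using that phi_real_valued[OF that] by (metis ereal_less_eq(3) real_of_ereal.simps(1))
  have "filterlim (\<lambda>x. real_of_ereal (\<phi> x) / x) at_top at_top"
    using strict by (simp add: phi_strict_superlinear_def)
  from bern_div_attains[OF real_phi_convex real_phi_1 this minor y \<delta>]
  obtain x where x: "0 < x" "x < y" "phi_bern_div x y = \<delta>" by metis
  have dec: "phi_bern_div q y < phi_bern_div p y" if "0 < p" "p < q" "q < y" for p q
    using that y by (intro bern_div_strict_decreasing real_phi_convex real_phi_1 phi_bern_div_pos) auto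
  have iff: "g_phi \<phi> \<delta> p \<le> y \<longleftrightarrow> p \<le> x" if p: "0 \<le> p" "p \<le> 1" for p
  proof -
    consider "p = 0" | "p = 1" | "0 < p" "p < y" | "p < 1" "y \<le> p" using p by linarith
    then show ?thesis
    proof cases
      case 3
      then have "g_phi \<phi> \<delta> p \<le> y \<longleftrightarrow> \<delta> \<le> phi_bern_div p y"
        using y \<delta> by (intro g_phi_le_iff_bern_div) auto
      also have "\<dots> \<longleftrightarrow> p \<le> x"
        using dec[of p x] dec[of x p] 3 x by (cases p x rule: linorder_cases) auto
      finally show ?thesis .
    next
      case 4
      then show ?thesis using g_phi_gt_self[of p \<delta>] y \<delta> x by auto
    qed (use x y in \<open>auto simp: g_phi_def\<close>)
  qed
  \<comment> \<open>A solution \<open>q < x\<close> has divergence above \<open>\<delta>\<close> at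
    \<open>y\<close>, hence by continuity also at some \<open>t < y\<close>, so that
    \<open>g q \<le> t < y\<close>.\<close>
  have eq: "q = x" if q: "0 \<le> q" "q \<le> 1" "g_phi \<phi> \<delta> q = y" for q
  proof (rule ccontr)
    assume "q \<noteq> x"
    with iff[of q] q have "q < x" by simp
    moreover have "q \<noteq> 0" using q y by (auto simp: g_phi_def)
    ultimately have q0: "0 < q" "q < x" using q by auto
    have "convex_on {0<..} (\<lambda>x. real_of_ereal (\<phi> x))"
      by (rule convex_on_subset[OF real_phi_convex]) auto
    then have cont: "continuous_on {0<..} (\<lambda>x. real_of_ereal (\<phi> x))"
      by (intro convex_on_continuous) auto
    have "continuous_on {0<..<1} (phi_bern_div q)"
      unfolding bern_div_def using q0 x y
      by (intro continuous_intros continuous_on_compose2[OF cont]) auto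
    then have "isCont (phi_bern_div q) y" using y by (simp add: continuous_on_eq_continuous_at)
    then have "((phi_bern_div q) \<longlongrightarrow> phi_bern_div q y) (at_left y)"
      unfolding isCont_def by (rule tendsto_within_subset) auto
    moreover have "\<delta> < phi_bern_div q y" using dec[OF q0 x(2)] x(3) by simp
    ultimately have "eventually (\<lambda>t. \<delta> < phi_bern_div q t) (at_left y)"
      by (rule order_tendstoD)
    moreover have "eventually (\<lambda>t. t \<in> {q<..<y}) (at_left y)"
      using q0 x by (intro eventually_at_left_real) auto
    ultimately have "eventually (\<lambda>t. \<delta> < phi_bern_div q t \<and> q < t \<and> t < y) (at_left y)"
      by eventually_elim auto
    then obtain t where t: "\<delta> < phi_bern_div q t" "q < t" "t < y"
      using eventually_happens' trivial_limit_at_left_real by blast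
    then have "g_phi \<phi> \<delta> q \<le> t"
      using g_phi_le_iff_bern_div[of q t \<delta>] q0 y \<delta> by simp
    then show False using q t by simp
  qed
  have gx: "g_phi \<phi> \<delta> x = y"
  proof (rule antisym)
    show "g_phi \<phi> \<delta> x \<le> y" using iff[of x] x y by simp
    have "phi_bern_div x y \<le> \<delta>" using x by simp
    then show "y \<le> g_phi \<phi> \<delta> x"
      using x y by (subst g_phi_eq_Sup) (auto intro!: cSup_upper bdd_aboveI[of _ 1])
  qed
  have "g_phi_inv \<phi> \<delta> y = x"
    unfolding g_phi_inv_def using gx eq x y by (intro the_equality) auto
  then show ?thesis using iff[OF p] by simp
qed

lemma SUP_LVaR_eq_LVaR_g_phi_inv:
  assumes P: "prob_space P" and \<delta>: "0 < \<delta>" and \<Lambda>: "in_H_I \<Lambda>" and X: "X \<in> borel_measurable P"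
  shows "(SUP Q\<in>P_phi P \<phi> \<delta>. LVaR P \<Lambda> (measure Q) X) = LVaR P (g_phi_inv \<phi> \<delta> \<circ> \<Lambda>) (measure P) X"
proof -
  interpret prob_space P by fact
  have "g_phi \<phi> \<delta> (measure P A) \<le> \<Lambda> x \<longleftrightarrow> measure P A \<le> g_phi_inv \<phi> \<delta> (\<Lambda> x)" for A x
    using \<Lambda> \<delta> by (intro g_phi_le_iff_le_g_phi_inv) (auto simp: in_H_I_def)
  then show ?thesis
    using SUP_LVaR_eq_LVaR_g_phi[OF P \<phi> _ _ X, of \<delta> \<Lambda>] \<delta> \<Lambda> by (simp add: LVaR_def in_H_I_def)
qed

text \<open>\<open>LVaR_plus\<close> is a lower bound for every radius, and each real level above it
  is admissible for all small radii.\<close>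

lemma SUP_LVaR_tendsto_LVaR_plus:
  assumes P: "prob_space P" and \<Lambda>: "in_H_I \<Lambda>" and X: "X \<in> borel_measurable P"
  shows "((\<lambda>\<delta>. SUP Q\<in>P_phi P \<phi> \<delta>. LVaR P \<Lambda> (measure Q) X) \<longlongrightarrow> LVaR_plus P \<Lambda> (measure P) X) (at_right 0)"
    (is "(?L \<longlongrightarrow> ?R) _")
proof -
  interpret prob_space P by fact
  define p where "p x = measure P {\<omega> \<in> space P. x < X \<omega>}" for x
  have p01: "0 \<le> p x" "p x \<le> 1" for x by (auto simp: p_def)
  have \<Lambda>01: "0 < \<Lambda> x" "\<Lambda> x < 1" and "mono \<Lambda>" for x using \<Lambda> by (auto simp: in_H_I_def)
  have L: "?L \<delta> = Inf {ereal x |x. g_phi \<phi> \<delta> (p x) \<le> \<Lambda> x}" if "0 < \<delta>" for \<delta>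
    using SUP_LVaR_eq_LVaR_g_phi[OF P \<phi> _ \<open>mono \<Lambda>\<close> X, of \<delta>] that by (simp add: LVaR_def p_def)
  have R: "?R = Sup {ereal x |x. \<Lambda> x \<le> p x}" by (simp add: LVaR_plus_def p_def)
  \<comment> \<open>If \<open>z < x\<close>, monotonicity carries
    \<open>\<Lambda> x \<le> p x\<close> down to \<open>\<Lambda> z \<le> p z\<close>, which
    contradicts \<open>g p > p\<close>, or \<open>g 1 = 1 > \<Lambda> z\<close> when
    \<open>p z = 1\<close>.\<close>
  have lower: "?R \<le> ?L \<delta>" if \<delta>: "0 < \<delta>" for \<delta>
    unfolding L[OF \<delta>] R
  proof (intro Sup_least Inf_greatest, safe)
    fix x z assume x: "\<Lambda> x \<le> p x" and z: "g_phi \<phi> \<delta> (p z) \<le> \<Lambda> z"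
    show "ereal x \<le> ereal z"
    proof (rule ccontr)
      assume "\<not> ereal x \<le> ereal z"
      then have "z < x" by simp
      then have "p x \<le> p z" unfolding p_def using X by (intro finite_measure_mono) auto
      moreover have "\<Lambda> z \<le> \<Lambda> x" using \<open>mono \<Lambda>\<close> \<open>z < x\<close> by (simp add: monoD)
      ultimately have pz: "\<Lambda> z \<le> p z" using x by simp
      then have "0 < p z" using \<Lambda>01[of z] by simp
      then show False
        using g_phi_gt_self[of "p z" \<delta>] p01(2)[of z] z pz \<Lambda>01[of z] \<delta>
        by (cases "p z = 1") (auto simp: g_phi_def)
    qed
  qed
  show ?thesis
  proof (rule order_tendstoI)
    fix a assume "a < ?R"
    then show "eventually (\<lambda>\<delta>. a < ?L \<delta>) (at_right 0)"
      using lower by (auto simp: eventually_at_right_field intro!: exI[of _ 1] less_le_trans[of a ?R])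
  next
    fix a assume "?R < a"
    then obtain y where y: "?R < ereal y" "ereal y < a" using ereal_dense2 by blast
    have py: "p y < \<Lambda> y"
    proof (rule ccontr)
      assume "\<not> p y < \<Lambda> y"
      then have "ereal y \<le> ?R" unfolding R by (intro Sup_upper) auto
      then show False using y by simp
    qed
    \<comment> \<open>The threshold is the divergence at \<open>(p y, \<Lambda> y)\<close>, positive
      by strict convexity; for \<open>p y = 0\<close> any radius works, since \<open>g\<close> is 0
      there.\<close>
    obtain d where d: "0 < d" "\<And>\<delta>. 0 < \<delta> \<Longrightarrow> \<delta> < d \<Longrightarrow> g_phi \<phi> \<delta> (p y) \<le> \<Lambda> y"
    proof (cases "p y = 0")
      case True
      then show thesis using that[of 1] \<Lambda>01[of y] by (simp add: g_phi_def)
    next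
      case False
      then have "0 < p y" using p01[of y] by simp
      then show thesis
        using that[of "phi_bern_div (p y) (\<Lambda> y)"] phi_bern_div_pos[of "p y" "\<Lambda> y"] py \<Lambda>01[of y]
          g_phi_le_iff_bern_div[of "p y" "\<Lambda> y"] by auto
    qed
    have "?L \<delta> < a" if "0 < \<delta>" "\<delta> < d" for \<delta>
    proof -
      have "?L \<delta> \<le> ereal y" unfolding L[OF that(1)] using d(2)[OF that] by (intro Inf_lower) auto
      then show ?thesis using y by simp
    qed
    then show "eventually (\<lambda>\<delta>. ?L \<delta> < a) (at_right 0)"
      using d(1) by (auto simp: eventually_at_right_field)
  qed
qed

end

theorem mainTheorem6:
  fixes P :: "'a measure" and \<phi> :: "real \<Rightarrow> ereal"
  assumes "prob_space P" and "phi_admissible \<phi>"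
  shows "(\<forall>\<delta>>0. \<forall>\<Lambda>. in_H_I \<Lambda> \<longrightarrow> (\<forall>X \<in> borel_measurable P.
            (SUP Q\<in>P_phi P \<phi> \<delta>. LVaR P \<Lambda> (measure Q) X)
              = LVaR P \<Lambda> (\<lambda>A. g_phi \<phi> \<delta> (measure P A)) X))
       \<and> (\<forall>\<delta>>0. \<forall>\<alpha>\<in>{0<..<1}. \<forall>X \<in> borel_measurable P.
            (SUP Q\<in>P_phi P \<phi> \<delta>. VaR P \<alpha> (measure Q) X)
              = VaR P \<alpha> (\<lambda>A. g_phi \<phi> \<delta> (measure P A)) X)
       \<and> (phi_strict_superlinear \<phi> \<longrightarrow>
            (\<forall>\<delta>>0. \<forall>\<Lambda>. in_H_I \<Lambda> \<longrightarrow> (\<forall>X \<in> borel_measurable P.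
               (SUP Q\<in>P_phi P \<phi> \<delta>. LVaR P \<Lambda> (measure Q) X)
                 = LVaR P (g_phi_inv \<phi> \<delta> \<circ> \<Lambda>) (measure P) X))
          \<and> (\<forall>\<delta>>0. \<forall>\<alpha>\<in>{0<..<1}. \<forall>X \<in> borel_measurable P.
               (SUP Q\<in>P_phi P \<phi> \<delta>. VaR P \<alpha> (measure Q) X)
                 = VaR P (g_phi_inv \<phi> \<delta> \<alpha>) (measure P) X)
          \<and> (\<forall>\<Lambda>. in_H_I \<Lambda> \<longrightarrow> (\<forall>X \<in> borel_measurable P.
               ((\<lambda>\<delta>. SUP Q\<in>P_phi P \<phi> \<delta>. LVaR P \<Lambda> (measure Q) X)
                  \<longlongrightarrow> LVaR_plus P \<Lambda> (measure P) X) (at_right 0)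
             \<and> ((\<lambda>\<delta>. LVaR P (g_phi_inv \<phi> \<delta> \<circ> \<Lambda>) (measure P) X)
                  \<longlongrightarrow> LVaR_plus P \<Lambda> (measure P) X) (at_right 0))))"
proof -
  \<comment> \<open>Constant levels turn the \<open>VaR\<close> claims into instances of the
    \<open>LVaR\<close> claims.\<close>
  have const: "in_H_I (\<lambda>_. \<alpha>)" if "\<alpha> \<in> {0<..<1}" for \<alpha> :: real
    using that by (auto simp: in_H_I_def mono_def)
  have g: "(SUP Q\<in>P_phi P \<phi> \<delta>. LVaR P \<Lambda> (measure Q) X) = LVaR P \<Lambda> (\<lambda>A. g_phi \<phi> \<delta> (measure P A)) X"
    if "0 < \<delta>" "in_H_I \<Lambda>" "X \<in> borel_measurable P" for \<delta> \<Lambda> X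
    using that by (intro SUP_LVaR_eq_LVaR_g_phi assms) (auto simp: in_H_I_def)
  have inv: "(SUP Q\<in>P_phi P \<phi> \<delta>. LVaR P \<Lambda> (measure Q) X) = LVaR P (g_phi_inv \<phi> \<delta> \<circ> \<Lambda>) (measure P) X"
    if "phi_strict_superlinear \<phi>" "0 < \<delta>" "in_H_I \<Lambda>" "X \<in> borel_measurable P" for \<delta> \<Lambda> X
    by (rule SUP_LVaR_eq_LVaR_g_phi_inv[OF assms(2) that(1) assms(1) that(2-4)])
  have lim: "((\<lambda>\<delta>. SUP Q\<in>P_phi P \<phi> \<delta>. LVaR P \<Lambda> (measure Q) X)
      \<longlongrightarrow> LVaR_plus P \<Lambda> (measure P) X) (at_right 0)"
    if "phi_strict_superlinear \<phi>" "in_H_I \<Lambda>" "X \<in> borel_measurable P" for \<Lambda> X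
    by (rule SUP_LVaR_tendsto_LVaR_plus[OF assms(2) that(1) assms(1) that(2-3)])
  have lim_inv: "((\<lambda>\<delta>. LVaR P (g_phi_inv \<phi> \<delta> \<circ> \<Lambda>) (measure P) X)
      \<longlongrightarrow> LVaR_plus P \<Lambda> (measure P) X) (at_right 0)"
    if "phi_strict_superlinear \<phi>" "in_H_I \<Lambda>" "X \<in> borel_measurable P" for \<Lambda> X
  proof (rule Lim_transform_eventually[OF lim[OF that]])
    show "eventually (\<lambda>\<delta>. (SUP Q\<in>P_phi P \<phi> \<delta>. LVaR P \<Lambda> (measure Q) X) =
        LVaR P (g_phi_inv \<phi> \<delta> \<circ> \<Lambda>) (measure P) X) (at_right 0)"
      using eventually_at_right_less[of 0] by eventually_elim (use inv that in blast)
  qed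
  have g_const: "(SUP Q\<in>P_phi P \<phi> \<delta>. VaR P \<alpha> (measure Q) X) = VaR P \<alpha> (\<lambda>A. g_phi \<phi> \<delta> (measure P A)) X"
    if "0 < \<delta>" "\<alpha> \<in> {0<..<1}" "X \<in> borel_measurable P" for \<delta> \<alpha> X
    unfolding VaR_def by (rule g[OF that(1) const[OF that(2)] that(3)])
  have inv_const: "(SUP Q\<in>P_phi P \<phi> \<delta>. VaR P \<alpha> (measure Q) X) = VaR P (g_phi_inv \<phi> \<delta> \<alpha>) (measure P) X"
    if "phi_strict_superlinear \<phi>" "0 < \<delta>" "\<alpha> \<in> {0<..<1}" "X \<in> borel_measurable P" for \<delta> \<alpha> X
    using inv[OF that(1,2) const[OF that(3)] that(4)] unfolding VaR_def by (simp add: comp_def)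
  show ?thesis by (intro conjI allI impI ballI g g_const inv inv_const lim lim_inv)
qed

end
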